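(* Let $\frac32<\alpha<2$ and let $g:[x',x'']\to\mathbb R$ be a continuous function of bounded $q$-variation, $\frac2{3-\alpha}<q<4$. Let $L_t^x$ be the local time of a symmetric $\alpha$-stable process, and let $\mathbf Z^2$ be the second level of the geometric rough path associated with $Z_x=(L_t^x,g(x))$. Then, almost surely, for every $(a,b)\in\Delta$ the integral $\int_a^bg(x)\,dL_t^x$ can be defined by $$\int_a^bg(x)\,dL_t^x=\lim_{m(D)\to0}\sum_{i=1}^r\Big[g(x_{i-1})\big(L_t^{x_i}-L_t^{x_{i-1}}\big)+(\mathbf Z^2_{x_{i-1},x_i})_{2,1}\Big],$$ i.e. the limit on the right-hand side, over finite partitions $D=\{a=x_0<x_1<\dots<x_r=b\}$ with mesh $m(D)\to0$, exists.
   Context: $X$ is a real-valued symmetric $\alpha$-stable process, $t\ge0$ is fixed, and $L_t^x$ is its jointly continuous local time (occupation density). $[x',x'']$ is a compact interval and $\Delta=\{(a,b):x'\le a\le b\le x''\}$. A control is a continuous $\mathbf w:\Delta\to[0,\infty)$ with $\mathbf w(a,a)=0$ and $\mathbf w(a,b)+\mathbf w(b,c)\le\mathbf w(a,c)$. Fix a control $\mathbf w$ with $|g(b)-g(a)|^q\le\mathbf w(a,b)$ and put $\mathbf w_1(a,b)=\mathbf w(a,b)+(b-a)$, $\mathbf w_1(x)=\mathbf w_1(x',x)$. Fix $p\in(\frac2{\alpha-1},4)$, put $\hat q=\max\{p,q\}$, $h=1/\hat q$. For $m\in\mathbb N$ let $x'=x_0^m<\dots<x_{2^m}^m=x''$ satisfy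 $\mathbf w_1(x_l^m)-\mathbf w_1(x_{l-1}^m)=2^{-m}\mathbf w_1(x',x'')$, and let $$Z(m)_x=Z_{x_{l-1}^m}+\frac{\mathbf w_1(x)-\mathbf w_1(x_{l-1}^m)}{\mathbf w_1(x_l^m)-\mathbf w_1(x_{l-1}^m)}(Z_{x_l^m}-Z_{x_{l-1}^m}),\qquad x_{l-1}^m\le x\le x_l^m,$$ $$\mathbf Z(m)^j_{a,b}=\int_{a<u_1<\dots<u_j<b}dZ(m)_{u_1}\otimes\dots\otimes dZ(m)_{u_j},\quad j=1,2,3.$$ The geometric rough path $\mathbf Z=(1,\mathbf Z^1,\mathbf Z^2,\mathbf Z^3)$ associated with $Z$ is the almost sure limit of $\mathbf Z(m)$ in the $\theta$-variation distance $\max_{1\le j\le3}\sup_D(\sum_l|\mathbf X^j_{x_{l-1},x_l}-\mathbf Y^j_{x_{l-1},x_l}|^{\theta/j})^{j/\theta}$, where $\theta$ satisfies $\theta>\hat q$ and $\frac4{2h+\alpha-1}<\theta<4$ (the existence of this limit is taken as known). $(\cdot)_{2,1}$ is the $(2,1)$ (lower-left) entry of an element of $\mathbb R^2\otimes\mathbb R^2$ viewed as a $2\times2$ matrix. *)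

theory Defs
  imports "HOL-Probability.Probability"
begin

section \<open>Partitions of a compact interval\<close>

text \<open>
  A finite partition \<open>a = x 0 < x 1 < \<dots> < x n = b\<close> is encoded as the pair \<open>(n, x)\<close>; the values of
  \<open>x\<close> beyond \<open>n\<close> are irrelevant. For \<open>a = b\<close> the only partitions are those with \<open>n = 0\<close>.
\<close>

definition partitions :: "real \<Rightarrow> real \<Rightarrow> (nat \<times> (nat \<Rightarrow> real)) set" where
  "partitions a b = {(n, x). x 0 = a \<and> x n = b \<and> (\<forall>i<n. x i < x (Suc i))}"

definition mesh_to_0 :: "real \<Rightarrow> real \<Rightarrow> (nat \<times> (nat \<Rightarrow> real)) filter" where
  "mesh_to_0 a b =
     (INF \<delta>\<in>{0<..}. principal {(n, x). (n, x) \<in> partitions a b \<and> (\<forall>i<n. x (Suc i) - x i < \<delta>)})"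

definition tagged_mesh_to_0 ::
    "real \<Rightarrow> real \<Rightarrow> (nat \<times> (nat \<Rightarrow> real) \<times> (nat \<Rightarrow> real)) filter" where
  "tagged_mesh_to_0 a b =
     (INF \<delta>\<in>{0<..}. principal {(n, x, s). (n, x) \<in> partitions a b \<and>
        (\<forall>i<n. s i \<in> {x i..x (Suc i)}) \<and> (\<forall>i<n. x (Suc i) - x i < \<delta>)})"

definition rs_integral :: "real \<Rightarrow> real \<Rightarrow> (real \<Rightarrow> real) \<Rightarrow> (real \<Rightarrow> real) \<Rightarrow> real" where
  \<comment> \<open>Riemann--Stieltjes integral of \<open>f\<close> against \<open>G\<close> over \<open>[a, b]\<close>\<close>
  "rs_integral a b f G =
     Lim (tagged_mesh_to_0 a b) (\<lambda>(n, x, s). \<Sum>i<n. f (s i) * (G (x (Suc i)) - G (x i)))"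

lemma mesh_to_0_neq_bot:
  assumes "a \<le> b"
  shows "mesh_to_0 a b \<noteq> bot"
proof -
  have ne: "\<exists>n x. (n, x) \<in> partitions a b \<and> (\<forall>i<n. x (Suc i) - x i < \<delta>)" if "\<delta> > 0" for \<delta>
  proof (cases "a = b")
    case True
    then have "(0, \<lambda>_. a) \<in> partitions a b" by (auto simp: partitions_def)
    then show ?thesis by (intro exI[of _ 0] exI[of _ "\<lambda>_. a"]) auto
  next
    case False
    with assms have ab: "a < b" by simp
    obtain n :: nat where n: "(b - a) / \<delta> < real n" using reals_Archimedean2 by blast
    have "(b - a) / \<delta> > 0" using ab that by simp
    with n have n0: "real n > 0" by linarith
    define x where "x i = a + real i * ((b - a) / real n)" for i
    have "(b - a) / real n < \<delta>" using n n0 that by (simp add: field_simps)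
    moreover have "x (Suc i) - x i = (b - a) / real n" for i by (simp add: x_def add_divide_distrib distrib_right)
    moreover from this have "x i < x (Suc i)" for i using ab n0 by (smt (verit) divide_pos_pos)
    moreover have "x 0 = a" "x n = b" using n0 by (auto simp: x_def)
    ultimately show ?thesis
      by (intro exI[of _ n] exI[of _ x]) (auto simp: partitions_def)
  qed
  show ?thesis
    unfolding mesh_to_0_def
  proof (rule INF_filter_not_bot)
    fix J :: "real set" assume J: "J \<subseteq> {0<..}" "finite J"
    define \<delta> where "\<delta> = Min (insert 1 J)"
    have "\<delta> > 0" using J by (auto simp: \<delta>_def)
    then obtain n x where nx: "(n, x) \<in> partitions a b" "\<forall>i<n. x (Suc i) - x i < \<delta>"
      using ne by blast
    have "\<delta> \<le> d" if "d \<in> J" for d using J that by (auto simp: \<delta>_def)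
    with nx have "(n, x) \<in> {(n, x). (n, x) \<in> partitions a b \<and> (\<forall>i<n. x (Suc i) - x i < d)}"
      if "d \<in> J" for d using that by fastforce
    then show "(INF d\<in>J. principal {(n, x). (n, x) \<in> partitions a b \<and> (\<forall>i<n. x (Suc i) - x i < d)}) \<noteq> bot"
      unfolding INF_principal_finite[OF J(2)] principal_eq_bot_iff by blast
  qed
qed

section \<open>Controls and bounded variation\<close>

definition ordered_pairs :: "real \<Rightarrow> real \<Rightarrow> (real \<times> real) set" where
  "ordered_pairs lo hi = {(a, b). lo \<le> a \<and> a \<le> b \<and> b \<le> hi}"

definition control :: "real \<Rightarrow> real \<Rightarrow> (real \<Rightarrow> real \<Rightarrow> real) \<Rightarrow> bool" where
  "control lo hi w \<longleftrightarrow>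
     continuous_on (ordered_pairs lo hi) (\<lambda>(a, b). w a b) \<and>
     (\<forall>(a, b)\<in>ordered_pairs lo hi. 0 \<le> w a b) \<and>
     (\<forall>a\<in>{lo..hi}. w a a = 0) \<and>
     (\<forall>a b c. lo \<le> a \<and> a \<le> b \<and> b \<le> c \<and> c \<le> hi \<longrightarrow> w a b + w b c \<le> w a c)"

definition bounded_q_variation :: "real \<Rightarrow> real \<Rightarrow> real \<Rightarrow> (real \<Rightarrow> real) \<Rightarrow> bool" where
  "bounded_q_variation q lo hi g \<longleftrightarrow>
     (\<exists>C. \<forall>(n, x)\<in>partitions lo hi. (\<Sum>i<n. \<bar>g (x (Suc i)) - g (x i)\<bar> powr q) \<le> C)"

section \<open>Symmetric stable processes and local times\<close>

definition cadlag :: "(real \<Rightarrow> real) \<Rightarrow> bool" where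
  "cadlag f \<longleftrightarrow> (\<forall>t\<ge>0. (f \<longlongrightarrow> f t) (at_right t)) \<and> (\<forall>t>0. \<exists>l. (f \<longlongrightarrow> l) (at_left t))"

text \<open>
  The Levy process with increments of characteristic function \<open>exp (- c h |u|\<^sup>\<alpha>)\<close> over time \<open>h\<close>;
  the scale \<open>c > 0\<close> is left free. Paths are indexed by \<open>real\<close>, only times \<open>t \<ge> 0\<close> matter.
\<close>

definition symmetric_stable_process :: "'a measure \<Rightarrow> real \<Rightarrow> (real \<Rightarrow> 'a \<Rightarrow> real) \<Rightarrow> bool" where
  "symmetric_stable_process M \<alpha> X \<longleftrightarrow>
     prob_space M \<and> 0 < \<alpha> \<and> \<alpha> \<le> 2 \<and>
     (\<forall>t\<ge>0. X t \<in> borel_measurable M) \<and>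
     (AE \<omega> in M. X 0 \<omega> = 0) \<and>
     (AE \<omega> in M. cadlag (\<lambda>t. X t \<omega>)) \<and>
     (\<forall>n (\<tau>::nat \<Rightarrow> real). 0 \<le> \<tau> 0 \<and> (\<forall>i<n. \<tau> i < \<tau> (Suc i)) \<longrightarrow>
        prob_space.indep_vars M (\<lambda>_. borel) (\<lambda>i \<omega>. X (\<tau> (Suc i)) \<omega> - X (\<tau> i) \<omega>) {..<n}) \<and>
     (\<exists>c>0. \<forall>s\<ge>0. \<forall>h\<ge>0. \<forall>u.
        char (distr M borel (\<lambda>\<omega>. X (s + h) \<omega> - X s \<omega>)) u =
          complex_of_real (exp (- c * h * \<bar>u\<bar> powr \<alpha>)))"

text \<open>
  \<open>L t x \<omega>\<close> is a jointly continuous density, with respect to Lebesgue measure, of the occupation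
  measure \<open>A \<mapsto> |{s \<in> [0, t]. X s \<omega> \<in> A}|\<close>.
\<close>

definition local_time ::
    "'a measure \<Rightarrow> (real \<Rightarrow> 'a \<Rightarrow> real) \<Rightarrow> (real \<Rightarrow> real \<Rightarrow> 'a \<Rightarrow> real) \<Rightarrow> bool" where
  "local_time M X L \<longleftrightarrow>
     (\<forall>t\<ge>0. \<forall>x. L t x \<in> borel_measurable M) \<and>
     (AE \<omega> in M.
        (\<forall>t\<ge>0. \<forall>x. 0 \<le> L t x \<omega>) \<and>
        continuous_on ({0..} \<times> UNIV) (\<lambda>(t, x). L t x \<omega>) \<and>
        (\<forall>t\<ge>0. distributed (restrict_space lborel {0..t}) lborel
                  (\<lambda>s. X s \<omega>) (\<lambda>x. ennreal (L t x \<omega>))))"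

section \<open>The approximating paths and their iterated integrals\<close>

definition w1 :: "(real \<Rightarrow> real \<Rightarrow> real) \<Rightarrow> real \<Rightarrow> real \<Rightarrow> real" where
  "w1 w a b = w a b + (b - a)"

definition dyadic_points ::
    "(real \<Rightarrow> real \<Rightarrow> real) \<Rightarrow> real \<Rightarrow> real \<Rightarrow> (nat \<Rightarrow> nat \<Rightarrow> real) \<Rightarrow> bool" where
  "dyadic_points w lo hi \<xi> \<longleftrightarrow>
     (\<forall>m. \<xi> m 0 = lo \<and> \<xi> m (2 ^ m) = hi \<and>
        (\<forall>l<2 ^ m. \<xi> m l < \<xi> m (Suc l) \<and>
           w1 w lo (\<xi> m (Suc l)) - w1 w lo (\<xi> m l) = w1 w lo hi / 2 ^ m))"

text \<open>
  On \<open>[\<xi> m l, \<xi> m (l + 1)]\<close> the path is linear in \<open>w1 w lo\<close>; the two formulas available at a common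
  endpoint agree, so the choice of the least \<open>l\<close> is immaterial.
\<close>

definition interpolation ::
    "(real \<Rightarrow> real \<Rightarrow> real) \<Rightarrow> real \<Rightarrow> (nat \<Rightarrow> nat \<Rightarrow> real) \<Rightarrow> (real \<Rightarrow> real ^ 2) \<Rightarrow> nat \<Rightarrow> real \<Rightarrow> real ^ 2"
  where
  "interpolation w lo \<xi> Z m x =
     (let l = (LEAST l. x \<le> \<xi> m (Suc l)) in
        Z (\<xi> m l) +
        ((w1 w lo x - w1 w lo (\<xi> m l)) / (w1 w lo (\<xi> m (Suc l)) - w1 w lo (\<xi> m l))) *\<^sub>R
          (Z (\<xi> m (Suc l)) - Z (\<xi> m l)))"

text \<open>
  Two-parameter functions with values in the truncated tensor algebra; the level-0 component, which
  is constantly 1, is left out. The coefficient of \<open>e\<^sub>i \<otimes> e\<^sub>j \<otimes> e\<^sub>k\<close> in a level-3 tensor \<open>T\<close> is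
  \<open>T $ i $ j $ k\<close>; in particular level 2 consists of \<open>2 \<times> 2\<close> matrices with row index first.
\<close>

type_synonym tensor_path =
  "(real \<Rightarrow> real \<Rightarrow> real ^ 2) \<times> (real \<Rightarrow> real \<Rightarrow> real ^ 2 ^ 2) \<times> (real \<Rightarrow> real \<Rightarrow> real ^ 2 ^ 2 ^ 2)"

definition level1 :: "tensor_path \<Rightarrow> real \<Rightarrow> real \<Rightarrow> real ^ 2" where
  "level1 T = fst T"

definition level2 :: "tensor_path \<Rightarrow> real \<Rightarrow> real \<Rightarrow> real ^ 2 ^ 2" where
  "level2 T = fst (snd T)"

definition level3 :: "tensor_path \<Rightarrow> real \<Rightarrow> real \<Rightarrow> real ^ 2 ^ 2 ^ 2" where
  "level3 T = snd (snd T)"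

definition iter1 :: "(real \<Rightarrow> real ^ 2) \<Rightarrow> real \<Rightarrow> real \<Rightarrow> real ^ 2" where
  "iter1 Y a b = (\<chi> i. rs_integral a b (\<lambda>_. 1) (\<lambda>u. Y u $ i))"

definition iter2 :: "(real \<Rightarrow> real ^ 2) \<Rightarrow> real \<Rightarrow> real \<Rightarrow> real ^ 2 ^ 2" where
  "iter2 Y a b = (\<chi> i j. rs_integral a b (\<lambda>u. iter1 Y a u $ i) (\<lambda>u. Y u $ j))"

definition iter3 :: "(real \<Rightarrow> real ^ 2) \<Rightarrow> real \<Rightarrow> real \<Rightarrow> real ^ 2 ^ 2 ^ 2" where
  "iter3 Y a b = (\<chi> i j k. rs_integral a b (\<lambda>u. iter2 Y a u $ i $ j) (\<lambda>u. Y u $ k))"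

definition iterated_integrals :: "(real \<Rightarrow> real ^ 2) \<Rightarrow> tensor_path" where
  "iterated_integrals Y = (iter1 Y, iter2 Y, iter3 Y)"

section \<open>Variation distance and the associated rough path\<close>

definition level_distance ::
    "real \<Rightarrow> real \<Rightarrow> real \<Rightarrow> nat \<Rightarrow> (real \<Rightarrow> real \<Rightarrow> 'b) \<Rightarrow> (real \<Rightarrow> real \<Rightarrow> 'b::real_normed_vector) \<Rightarrow> ennreal"
  where
  "level_distance \<theta> lo hi j S T =
     (SUP (n, x)\<in>partitions lo hi.
        ennreal ((\<Sum>i<n. norm (S (x i) (x (Suc i)) - T (x i) (x (Suc i))) powr (\<theta> / real j))
          powr (real j / \<theta>)))"

definition variation_distance ::
    "real \<Rightarrow> real \<Rightarrow> real \<Rightarrow> tensor_path \<Rightarrow> tensor_path \<Rightarrow> ennreal" where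
  "variation_distance \<theta> lo hi S T =
     Max {level_distance \<theta> lo hi 1 (level1 S) (level1 T),
          level_distance \<theta> lo hi 2 (level2 S) (level2 T),
          level_distance \<theta> lo hi 3 (level3 S) (level3 T)}"

definition associated_rough_path ::
    "'a measure \<Rightarrow> real \<Rightarrow> real \<Rightarrow> real \<Rightarrow> (real \<Rightarrow> real \<Rightarrow> real) \<Rightarrow> (nat \<Rightarrow> nat \<Rightarrow> real) \<Rightarrow>
      ('a \<Rightarrow> real \<Rightarrow> real ^ 2) \<Rightarrow> ('a \<Rightarrow> tensor_path) \<Rightarrow> bool" where
  "associated_rough_path M \<theta> lo hi w \<xi> Z ZZ \<longleftrightarrow>
     (AE \<omega> in M.
        (\<lambda>m. variation_distance \<theta> lo hi
               (iterated_integrals (interpolation w lo \<xi> (Z \<omega>) m)) (ZZ \<omega>)) \<longlonglongrightarrow> 0)"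

end

theory Submission imports Defs begin

text \<open>
  The summand \<open>g(u) (L\<^sup>v - L\<^sup>u) + (\<^bold>Z\<^sup>2\<^sub>u\<^sub>,\<^sub>v)\<^sub>2\<^sub>,\<^sub>1\<close> is additive in the interval \<open>[u, v]\<close>: for the approximating
  paths it is the Riemann--Stieltjes integral of the second coordinate against the first, and
  additivity survives the limit because the level-2 variation distance dominates the error on each
  single interval. Hence, on the almost sure event where the local time is continuous and the rough
  path exists, the sums do not depend on the partition at all.
\<close>

section \<open>Partitions\<close>

lemma partitions_mono:
  assumes "(n, x) \<in> partitions a b" "i \<le> j" "j \<le> n"
  shows "x i \<le> x j"
  using assms(2,3)
proof (induction j rule: dec_induct)
  case (step k)
  then have "x k < x (Suc k)" using assms(1) by (auto simp: partitions_def)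
  with step show ?case by simp
qed simp

lemma partitions_bounds:
  assumes "(n, x) \<in> partitions a b" "i \<le> n"
  shows "a \<le> x i" "x i \<le> b"
  using partitions_mono[OF assms(1), of 0 i] partitions_mono[OF assms(1), of i n] assms
  by (auto simp: partitions_def)

lemma partitions_piece_exists:
  assumes P: "(n, x) \<in> partitions a b" and "a < b" "a \<le> z" "z \<le> b"
  obtains i where "i < n" "x i \<le> z" "z \<le> x (Suc i)"
proof -
  have x: "x 0 = a" "x n = b" using P by (auto simp: partitions_def)
  with \<open>a < b\<close> have "0 < n" by (cases n) auto
  define i where "i = (LEAST i. z \<le> x (Suc i))"
  \<comment> \<open>The last piece ends at \<open>b\<close>, so some index satisfies the condition
    and the least one is meaningful.\<close>
  have last: "z \<le> x (Suc (n - 1))" using x \<open>0 < n\<close> \<open>z \<le> b\<close> by simp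
  then have "i \<le> n - 1" "z \<le> x (Suc i)"
    unfolding i_def by (auto intro: Least_le LeastI)
  moreover have "x i \<le> z"
  proof (cases i)
    case 0
    then show ?thesis using x assms by simp
  next
    case (Suc k)
    then have "\<not> z \<le> x (Suc k)" unfolding i_def by (intro not_less_Least) simp
    with Suc show ?thesis by simp
  qed
  ultimately show thesis using \<open>0 < n\<close> by (intro that[of i]) auto
qed

text \<open>Reduces a property that survives the joining of adjacent intervals to the pieces of a
  partition. It is used to build a primitive on the whole interval from primitives on the dyadic
  pieces.\<close>

lemma partitions_induct:
  assumes P: "(n, x) \<in> partitions a b" and "a < b"
    and piece: "\<And>i. i < n \<Longrightarrow> P (x i) (x (Suc i))"
    and join: "\<And>u c v. u \<le> c \<Longrightarrow> c \<le> v \<Longrightarrow> P u c \<Longrightarrow> P c v \<Longrightarrow> P u v"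
  shows "P a b"
proof -
  have x: "x 0 = a" "x n = b" using P by (auto simp: partitions_def)
  with \<open>a < b\<close> have "0 < n" by (cases n) auto
  \<comment> \<open>The prefixes start with one piece, since the empty prefix would require
    \<open>P a a\<close>.\<close>
  have "P (x 0) (x (Suc k))" if "Suc k \<le> n" for k
    using that
  proof (induction k)
    case (Suc k)
    with join[of "x 0" "x (Suc k)" "x (Suc (Suc k))"] piece[of "Suc k"]
      partitions_mono[OF P, of 0 "Suc k"] partitions_mono[OF P, of "Suc k" "Suc (Suc k)"]
    show ?case by simp
  qed (use piece in simp)
  from this[of "n - 1"] x \<open>0 < n\<close> show ?thesis by simp
qed

text \<open>Every nondegenerate subinterval is a piece of some partition, so a supremum over
  partitions controls each single interval.\<close>

lemma partition_through:
  assumes "lo \<le> a" "a < b" "b \<le> hi"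
  obtains n x i where "(n, x) \<in> partitions lo hi" "i < n" "x i = a" "x (Suc i) = (b::real)"
proof -
  \<comment> \<open>The points \<open>lo, a, b, hi\<close> in order. Partitions are strictly
    increasing, so repeated points must go: shifting the index by one drops \<open>lo\<close> when
    it equals \<open>a\<close>, and stopping one index earlier drops \<open>hi\<close> when it
    equals \<open>b\<close>.\<close>
  define y where "y i = (if i = 0 then lo else if i = 1 then a else if i = 2 then b else hi)"
    for i :: nat
  consider "lo = a" "b = hi" | "lo = a" "b < hi" | "lo < a" "b = hi" | "lo < a" "b < hi"
    using assms by linarith
  then show thesis
  proof cases
    case 1
    with assms show thesis
      by (intro that[of 1 "\<lambda>i. y (Suc i)" 0]) (auto simp: partitions_def y_def)
  next
    case 2
    with assms show thesis
      by (intro that[of 2 "\<lambda>i. y (Suc i)" 0]) (auto simp: partitions_def y_def)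
  next
    case 3
    with assms show thesis
      by (intro that[of 2 y 1]) (auto simp: partitions_def y_def numeral_2_eq_2 less_Suc_eq)
  next
    case 4
    with assms show thesis
      by (intro that[of 3 y 1]) (auto simp: partitions_def y_def numeral_2_eq_2 numeral_3_eq_3 less_Suc_eq)
  qed
qed

section \<open>Partition filters as the mesh tends to zero\<close>

lemma eventually_mesh_to_0:
  "eventually P (mesh_to_0 a b) \<longleftrightarrow>
     (\<exists>\<delta>>0. \<forall>n x. (n, x) \<in> partitions a b \<longrightarrow> (\<forall>i<n. x (Suc i) - x i < \<delta>) \<longrightarrow> P (n, x))"
  unfolding mesh_to_0_def
proof (subst eventually_INF_base, goal_cases)
  case (2 d e)
  then show ?case by (intro bexI[of _ "min d e"]) auto
qed (auto simp: eventually_principal Bex_def)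

lemma eventually_tagged_mesh_to_0:
  "eventually P (tagged_mesh_to_0 a b) \<longleftrightarrow>
     (\<exists>\<delta>>0. \<forall>n x s. (n, x) \<in> partitions a b \<longrightarrow> (\<forall>i<n. s i \<in> {x i..x (Suc i)}) \<longrightarrow>
        (\<forall>i<n. x (Suc i) - x i < \<delta>) \<longrightarrow> P (n, x, s))"
  unfolding tagged_mesh_to_0_def
proof (subst eventually_INF_base, goal_cases)
  case (2 d e)
  then show ?case by (intro bexI[of _ "min d e"]) auto
qed (auto simp: eventually_principal Bex_def)

text \<open>Left endpoints are admissible tags, so nontriviality is inherited from the untagged
  filter. It makes limits along the tagged filter unique.\<close>

lemma tagged_mesh_to_0_neq_bot:
  assumes "a \<le> b"
  shows "tagged_mesh_to_0 a b \<noteq> bot"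
proof
  assume "tagged_mesh_to_0 a b = bot"
  then have "eventually (\<lambda>_. False) (tagged_mesh_to_0 a b)" by simp
  then obtain \<delta> where \<delta>: "\<delta> > 0"
    "\<And>n x s. (n, x) \<in> partitions a b \<Longrightarrow> \<forall>i<n. s i \<in> {x i..x (Suc i)} \<Longrightarrow>
       \<forall>i<n. x (Suc i) - x i < \<delta> \<Longrightarrow> False"
    unfolding eventually_tagged_mesh_to_0 by blast
  have "False" if "(n, x) \<in> partitions a b" "\<forall>i<n. x (Suc i) - x i < \<delta>" for n x
    using that \<delta>(2)[of n x x] by (auto simp: partitions_def less_imp_le)
  then have "eventually (\<lambda>_. False) (mesh_to_0 a b)"
    unfolding eventually_mesh_to_0 using \<delta>(1) by blast
  then show False using mesh_to_0_neq_bot[OF assms] by simp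
qed

section \<open>Riemann--Stieltjes integrals of paths that are Lipschitz in a clock\<close>

text \<open>\<open>rs_integral\<close> is a \<open>Lim\<close> and says nothing until a limit is
  known to exist, so every evaluation below exhibits the limit first.\<close>

lemma rs_integral_eqI:
  assumes "a \<le> b"
    and "((\<lambda>(n, x, s). \<Sum>i<n. f (s i) * (G (x (Suc i)) - G (x i))) \<longlongrightarrow> I) (tagged_mesh_to_0 a b)"
  shows "rs_integral a b f G = I"
  unfolding rs_integral_def by (rule tendsto_Lim[OF tagged_mesh_to_0_neq_bot[OF assms(1)] assms(2)])

lemma rs_integral_one:
  assumes "a \<le> b"
  shows "rs_integral a b (\<lambda>_. 1) G = G b - G a"
proof (rule rs_integral_eqI[OF assms tendsto_eventually])
  have "(\<Sum>i<n. 1 * (G (x (Suc i)) - G (x i))) = G b - G a" if "(n, x) \<in> partitions a b" for n x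
    using that sum_lessThan_telescope[of "\<lambda>i. G (x i)" n] by (auto simp: partitions_def)
  then show "\<forall>\<^sub>F t in tagged_mesh_to_0 a b.
      (case t of (n, x, s) \<Rightarrow> \<Sum>i<n. 1 * (G (x (Suc i)) - G (x i))) = G b - G a"
    unfolding eventually_tagged_mesh_to_0 by (intro exI[of _ 1]) auto
qed

text \<open>Quadratic error in the clock \<open>\<psi>\<close> is what makes \<open>F b - F a\<close> the integral of \<open>f\<close> against \<open>G\<close>.\<close>

definition rs_primitive ::
    "(real \<Rightarrow> real) \<Rightarrow> (real \<Rightarrow> real) \<Rightarrow> (real \<Rightarrow> real) \<Rightarrow> real \<Rightarrow> real \<Rightarrow> real \<Rightarrow> (real \<Rightarrow> real) \<Rightarrow> bool"
  where
  "rs_primitive \<psi> f G K a b F \<longleftrightarrow>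
     (\<forall>u s v. a \<le> u \<and> u \<le> s \<and> s \<le> v \<and> v \<le> b \<longrightarrow>
        \<bar>F v - F u - f s * (G v - G u)\<bar> \<le> K * (\<psi> v - \<psi> u)\<^sup>2)"

lemma rs_primitiveD:
  assumes "rs_primitive \<psi> f G K a b F" "a \<le> u" "u \<le> s" "s \<le> v" "v \<le> b"
  shows "\<bar>F v - F u - f s * (G v - G u)\<bar> \<le> K * (\<psi> v - \<psi> u)\<^sup>2"
  using assms unfolding rs_primitive_def by blast

text \<open>The increments of \<open>F\<close> telescope, so the error of a tagged sum is bounded by
  \<open>K\<close> times the sum of the squared clock increments. One factor of each square is
  uniformly small by uniform continuity of \<open>\<psi>\<close> on the compact interval, and the
  other factors sum to \<open>\<psi> b - \<psi> a\<close>.\<close>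

lemma tendsto_rs_primitive:
  assumes F: "rs_primitive \<psi> f G K lo hi F" and ab: "lo \<le> a" "b \<le> hi"
    and \<psi>: "continuous_on {lo..hi} \<psi>" "mono_on {lo..hi} \<psi>"
  shows "((\<lambda>(n, x, s). \<Sum>i<n. f (s i) * (G (x (Suc i)) - G (x i))) \<longlongrightarrow> F b - F a)
    (tagged_mesh_to_0 a b)"
proof (rule tendstoI)
  fix e :: real assume "e > 0"
  \<comment> \<open>Chosen so that clock increments below \<open>e / W\<close> give a total error
    below \<open>e\<close>; the absolute values and the added 1 keep \<open>W\<close> positive
    whatever the sign of \<open>K\<close>, even if the clock does not move.\<close>
  define W where "W = \<bar>K\<bar> * \<bar>\<psi> b - \<psi> a\<bar> + 1"
  have "W > 0" by (simp add: W_def add_nonneg_pos)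
  have "uniformly_continuous_on {lo..hi} \<psi>"
    using \<psi>(1) by (simp add: compact_uniformly_continuous)
  then obtain \<delta> where "\<delta> > 0" and \<delta>: "\<And>u v. u \<in> {lo..hi} \<Longrightarrow> v \<in> {lo..hi} \<Longrightarrow> dist v u < \<delta> \<Longrightarrow>
      dist (\<psi> v) (\<psi> u) < e / W"
    unfolding uniformly_continuous_on_def using \<open>e > 0\<close> \<open>W > 0\<close> by (metis divide_pos_pos)
  have "dist (\<Sum>i<n. f (s i) * (G (x (Suc i)) - G (x i))) (F b - F a) < e"
    if P: "(n, x) \<in> partitions a b" and s: "\<forall>i<n. s i \<in> {x i..x (Suc i)}"
      and m: "\<forall>i<n. x (Suc i) - x i < \<delta>" for n x s
  proof -
    have x: "x 0 = a" "x n = b" "\<And>i. i < n \<Longrightarrow> x i < x (Suc i)"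
      using P by (auto simp: partitions_def)
    have rng: "x i \<in> {lo..hi}" if "i \<le> n" for i
      using partitions_bounds[OF P that] ab by auto
    have err: "\<bar>(F (x (Suc i)) - F (x i)) - f (s i) * (G (x (Suc i)) - G (x i))\<bar>
        \<le> \<bar>K\<bar> * (e / W * (\<psi> (x (Suc i)) - \<psi> (x i)))" if "i < n" for i
    proof -
      have r: "x i \<in> {lo..hi}" "x (Suc i) \<in> {lo..hi}" using rng that by auto
      have d: "0 \<le> \<psi> (x (Suc i)) - \<psi> (x i)"
        using mono_onD[OF \<psi>(2) r] x(3)[OF that] by simp
      have "\<psi> (x (Suc i)) - \<psi> (x i) \<le> e / W"
        using \<delta>[OF r] m that x(3)[OF that] by (auto simp: dist_real_def)
      with d have "(\<psi> (x (Suc i)) - \<psi> (x i))\<^sup>2 \<le> e / W * (\<psi> (x (Suc i)) - \<psi> (x i))"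
        unfolding power2_eq_square by (intro mult_right_mono)
      then have "\<bar>K\<bar> * (\<psi> (x (Suc i)) - \<psi> (x i))\<^sup>2 \<le> \<bar>K\<bar> * (e / W * (\<psi> (x (Suc i)) - \<psi> (x i)))"
        by (intro mult_left_mono) auto
      moreover have "K * (\<psi> (x (Suc i)) - \<psi> (x i))\<^sup>2 \<le> \<bar>K\<bar> * (\<psi> (x (Suc i)) - \<psi> (x i))\<^sup>2"
        by (intro mult_right_mono) auto
      moreover have "\<bar>(F (x (Suc i)) - F (x i)) - f (s i) * (G (x (Suc i)) - G (x i))\<bar>
          \<le> K * (\<psi> (x (Suc i)) - \<psi> (x i))\<^sup>2"
        using s that r by (intro rs_primitiveD[OF F]) auto
      ultimately show ?thesis by linarith
    qed
    have tel: "(\<Sum>i<n. H (x (Suc i)) - H (x i)) = H b - H a" for H :: "real \<Rightarrow> real"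
      using sum_lessThan_telescope[of "\<lambda>i. H (x i)" n] x by simp
    have "\<bar>(F b - F a) - (\<Sum>i<n. f (s i) * (G (x (Suc i)) - G (x i)))\<bar>
        = \<bar>\<Sum>i<n. (F (x (Suc i)) - F (x i)) - f (s i) * (G (x (Suc i)) - G (x i))\<bar>"
      by (subst sum_subtractf) (simp only: tel)
    also have "\<dots> \<le> (\<Sum>i<n. \<bar>K\<bar> * (e / W * (\<psi> (x (Suc i)) - \<psi> (x i))))"
      by (rule order.trans[OF sum_abs sum_mono]) (use err in auto)
    also have "\<dots> = e / W * (\<bar>K\<bar> * (\<psi> b - \<psi> a))"
      unfolding sum_distrib_left[symmetric] tel by (rule mult.left_commute)
    also have "\<dots> \<le> e / W * (\<bar>K\<bar> * \<bar>\<psi> b - \<psi> a\<bar>)"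
      using \<open>e > 0\<close> \<open>W > 0\<close> by (intro mult_left_mono) auto
    also have "\<dots> < e / W * W"
      using \<open>e > 0\<close> \<open>W > 0\<close> by (intro mult_strict_left_mono) (auto simp: W_def)
    also have "\<dots> = e" using \<open>W > 0\<close> by simp
    finally show ?thesis by (simp add: dist_real_def abs_minus_commute)
  qed
  then show "\<forall>\<^sub>F t in tagged_mesh_to_0 a b.
      dist (case t of (n, x, s) \<Rightarrow> \<Sum>i<n. f (s i) * (G (x (Suc i)) - G (x i))) (F b - F a) < e"
    unfolding eventually_tagged_mesh_to_0 using \<open>\<delta> > 0\<close> by auto
qed

section \<open>Joining primitives across adjacent intervals\<close>

text \<open>Joining two primitives produces products of an increment of \<open>f\<close> and an
  increment of \<open>G\<close>. Lipschitz bounds in the clock make these products quadratic in the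
  clock, as \<open>rs_primitive\<close> demands.\<close>

definition clock_lipschitz :: "(real \<Rightarrow> real) \<Rightarrow> (real \<Rightarrow> real) \<Rightarrow> real \<Rightarrow> real \<Rightarrow> real \<Rightarrow> bool" where
  "clock_lipschitz \<psi> f K a b \<longleftrightarrow>
     (\<forall>u v. a \<le> u \<and> u \<le> v \<and> v \<le> b \<longrightarrow> \<bar>f v - f u\<bar> \<le> K * (\<psi> v - \<psi> u))"

lemma clock_lipschitzD:
  assumes "clock_lipschitz \<psi> f K a b" "a \<le> u" "u \<le> v" "v \<le> b"
  shows "\<bar>f v - f u\<bar> \<le> K * (\<psi> v - \<psi> u)"
  using assms unfolding clock_lipschitz_def by blast

lemma clock_lipschitz_mono:
  assumes "clock_lipschitz \<psi> f K a b" "K \<le> K'" "mono_on {a..b} \<psi>"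
  shows "clock_lipschitz \<psi> f K' a b"
  unfolding clock_lipschitz_def
proof (intro allI impI, elim conjE)
  fix u v assume uv: "a \<le> u" "u \<le> v" "v \<le> b"
  then have "\<psi> u \<le> \<psi> v" using mono_onD[OF assms(3), of u v] by simp
  then have "K * (\<psi> v - \<psi> u) \<le> K' * (\<psi> v - \<psi> u)"
    using assms(2) by (intro mult_right_mono) auto
  then show "\<bar>f v - f u\<bar> \<le> K' * (\<psi> v - \<psi> u)"
    using clock_lipschitzD[OF assms(1) uv] by linarith
qed

lemma clock_lipschitz_join:
  assumes "clock_lipschitz \<psi> f K a c" "clock_lipschitz \<psi> f K c b"
  shows "clock_lipschitz \<psi> f K a b"
  unfolding clock_lipschitz_def
proof (intro allI impI, elim conjE)
  fix u v assume uv: "a \<le> u" "u \<le> v" "v \<le> b"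
  consider "v \<le> c" | "c \<le> u" | "u \<le> c" "c \<le> v" by linarith
  then show "\<bar>f v - f u\<bar> \<le> K * (\<psi> v - \<psi> u)"
  proof cases
    case 3
    with clock_lipschitzD[OF assms(1), of u c] clock_lipschitzD[OF assms(2), of c v] uv
    show ?thesis by (auto simp: algebra_simps)
  qed (use clock_lipschitzD[OF assms(1), of u v] clock_lipschitzD[OF assms(2), of u v] uv in auto)
qed

text \<open>If \<open>[u, v]\<close> straddles \<open>c\<close>, the tag \<open>s\<close> belongs to
  one side only. On the other side \<open>f s\<close> is replaced by \<open>f c\<close>; the cost is
  the product of \<open>f c - f s\<close> with an increment of \<open>G\<close>, which accounts for
  the term \<open>K\<^sup>2\<close>.\<close>

lemma rs_primitive_join:
  assumes F1: "rs_primitive \<psi> f G K1 a c F1" and F2: "rs_primitive \<psi> f G K2 c b F2"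
    and K: "0 \<le> K1" "0 \<le> K2" "0 \<le> K"
    and f: "clock_lipschitz \<psi> f K a b" and G: "clock_lipschitz \<psi> G K a b"
    and mono: "mono_on {a..b} \<psi>" and c: "a \<le> c" "c \<le> b"
  shows "rs_primitive \<psi> f G (K1 + K2 + K\<^sup>2) a b (\<lambda>x. if x \<le> c then F1 x else F1 c + F2 x - F2 c)"
    (is "rs_primitive _ _ _ _ _ _ ?F")
  unfolding rs_primitive_def
proof (intro allI impI, elim conjE)
  fix u s v assume h: "a \<le> u" "u \<le> s" "s \<le> v" "v \<le> b"
  \<comment> \<open>Both branches give \<open>F1 c\<close> at \<open>c\<close>, so the right-hand
    formula may be used there too.\<close>
  have F_right: "?F x = F1 c + F2 x - F2 c" if "c \<le> x" for x
    using that by (cases "x = c") auto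
  have le: "\<psi> x \<le> \<psi> y" if "a \<le> x" "x \<le> y" "y \<le> b" for x y
    using mono_onD[OF mono, of x y] that by simp
  have K1: "K1 * (\<psi> y - \<psi> x)\<^sup>2 \<le> K1 * (\<psi> v - \<psi> u)\<^sup>2"
    and K2: "K2 * (\<psi> y - \<psi> x)\<^sup>2 \<le> K2 * (\<psi> v - \<psi> u)\<^sup>2"
    if "u \<le> x" "x \<le> y" "y \<le> v" for x y
    using that h K le[of u x] le[of x y] le[of y v]
    by (auto intro!: mult_left_mono power_mono)
  have cross: "\<bar>(f y - f x) * (G y' - G x')\<bar> \<le> K\<^sup>2 * (\<psi> v - \<psi> u)\<^sup>2"
    if "u \<le> x" "x \<le> y" "y \<le> v" "u \<le> x'" "x' \<le> y'" "y' \<le> v" for x y x' y'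
  proof -
    have "\<bar>f y - f x\<bar> \<le> K * (\<psi> v - \<psi> u)"
    proof -
      have "K * (\<psi> y - \<psi> x) \<le> K * (\<psi> v - \<psi> u)"
        using that h K le[of u x] le[of y v] by (intro mult_left_mono) auto
      with clock_lipschitzD[OF f, of x y] that h show ?thesis by auto
    qed
    moreover have "\<bar>G y' - G x'\<bar> \<le> K * (\<psi> v - \<psi> u)"
    proof -
      have "K * (\<psi> y' - \<psi> x') \<le> K * (\<psi> v - \<psi> u)"
        using that h K le[of u x'] le[of y' v] by (intro mult_left_mono) auto
      with clock_lipschitzD[OF G, of x' y'] that h show ?thesis by auto
    qed
    ultimately have "\<bar>f y - f x\<bar> * \<bar>G y' - G x'\<bar> \<le> (K * (\<psi> v - \<psi> u)) * (K * (\<psi> v - \<psi> u))"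
      by (intro mult_mono) auto
    then show ?thesis by (simp add: abs_mult power2_eq_square mult_ac)
  qed
  have nn: "0 \<le> K1 * (\<psi> v - \<psi> u)\<^sup>2" "0 \<le> K2 * (\<psi> v - \<psi> u)\<^sup>2" "0 \<le> K\<^sup>2 * (\<psi> v - \<psi> u)\<^sup>2"
    using K by auto
  have "\<bar>?F v - ?F u - f s * (G v - G u)\<bar>
      \<le> K1 * (\<psi> v - \<psi> u)\<^sup>2 + K2 * (\<psi> v - \<psi> u)\<^sup>2 + K\<^sup>2 * (\<psi> v - \<psi> u)\<^sup>2"
  proof -
    consider "v \<le> c" | "c \<le> u" | "u \<le> c" "c \<le> v" "s \<le> c" | "u \<le> c" "c \<le> v" "c \<le> s" by linarith
    then show ?thesis
    proof cases
      case 1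
      then have "?F v - ?F u - f s * (G v - G u) = F1 v - F1 u - f s * (G v - G u)"
        using h by simp
      then show ?thesis using rs_primitiveD[OF F1, of u s v] 1 h nn by linarith
    next
      case 2
      then have "?F v - ?F u - f s * (G v - G u) = F2 v - F2 u - f s * (G v - G u)"
        using h F_right[of u] F_right[of v] by linarith
      then show ?thesis using rs_primitiveD[OF F2, of u s v] 2 h nn by linarith
    next
      case 3
      have "?F v - ?F u - f s * (G v - G u) =
          (F1 c - F1 u - f s * (G c - G u)) + (F2 v - F2 c - f c * (G v - G c))
          + (f c - f s) * (G v - G c)"
        using 3 by (simp only: F_right) (simp add: algebra_simps)
      then show ?thesis
        using rs_primitiveD[OF F1, of u s c] rs_primitiveD[OF F2, of c c v] K1[of u c] K2[of c v]
          cross[of s c c v] 3 h by linarith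
    next
      case 4
      have "?F v - ?F u - f s * (G v - G u) =
          (F1 c - F1 u - f c * (G c - G u)) + (F2 v - F2 c - f s * (G v - G c))
          - (f s - f c) * (G c - G u)"
        using 4 by (simp only: F_right) (simp add: algebra_simps)
      then show ?thesis
        using rs_primitiveD[OF F1, of u c c] rs_primitiveD[OF F2, of c s v] K1[of u c] K2[of c v]
          cross[of c s u c] 4 h by linarith
    qed
  qed
  then show "\<bar>?F v - ?F u - f s * (G v - G u)\<bar> \<le> (K1 + K2 + K\<^sup>2) * (\<psi> v - \<psi> u)\<^sup>2"
    by (simp add: distrib_right)
qed

text \<open>For \<open>f\<close> and \<open>G\<close> affine in the clock the trapezoidal rule is
  exact: \<open>F v - F u\<close> is the average of \<open>f u\<close> and \<open>f v\<close> times
  the increment of \<open>G\<close>. Replacing that average by \<open>f s\<close> moves the clock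
  value from the midpoint to that of the tag, a shift of at most
  \<open>\<psi> v - \<psi> u\<close>.\<close>

lemma rs_primitive_linear:
  assumes f: "\<And>u v. u \<in> {a..b} \<Longrightarrow> v \<in> {a..b} \<Longrightarrow> f v - f u = c * (\<psi> v - \<psi> u)"
    and G: "\<And>u v. u \<in> {a..b} \<Longrightarrow> v \<in> {a..b} \<Longrightarrow> G v - G u = d * (\<psi> v - \<psi> u)"
    and mono: "mono_on {a..b} \<psi>"
  shows "rs_primitive \<psi> f G \<bar>c * d\<bar> a b (\<lambda>x. (f a + f x) / 2 * (G x - G a))"
  unfolding rs_primitive_def
proof (intro allI impI, elim conjE)
  fix u s v assume h: "a \<le> u" "u \<le> s" "s \<le> v" "v \<le> b"
  define U S V where "U = \<psi> u - \<psi> a" and "S = \<psi> s - \<psi> a" and "V = \<psi> v - \<psi> a"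
  have US: "U \<le> S" "S \<le> V"
    using mono_onD[OF mono, of u s] mono_onD[OF mono, of s v] h by (auto simp: U_def S_def V_def)
  have fx: "f u = f a + c * U" "f s = f a + c * S" "f v = f a + c * V"
    and Gx: "G u = G a + d * U" "G v = G a + d * V"
    using f[of a u] f[of a s] f[of a v] G[of a u] G[of a v] h by (auto simp: U_def S_def V_def)
  have "(f a + f v) / 2 * (G v - G a) - (f a + f u) / 2 * (G u - G a) - f s * (G v - G u)
      = c * d * ((V - U) * ((U + V) / 2 - S))"
    unfolding fx Gx by (simp add: field_simps)
  moreover have "\<bar>(V - U) * ((U + V) / 2 - S)\<bar> \<le> (V - U) * (V - U)"
    unfolding abs_mult using US by (intro mult_mono) (auto simp: abs_le_iff field_simps)
  ultimately show "\<bar>(f a + f v) / 2 * (G v - G a) - (f a + f u) / 2 * (G u - G a) - f s * (G v - G u)\<bar>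
      \<le> \<bar>c * d\<bar> * (\<psi> v - \<psi> u)\<^sup>2"
    by (simp add: abs_mult[of "c * d"] power2_eq_square mult_left_mono U_def V_def)
qed

text \<open>Trapezoidal primitives on the affine pieces are joined one after another.\<close>

lemma rs_primitive_exists:
  assumes P: "(n, x) \<in> partitions lo hi" "lo < hi" and mono: "mono_on {lo..hi} \<psi>"
    and f: "\<And>i. i < n \<Longrightarrow> \<exists>c. \<forall>u\<in>{x i..x (Suc i)}. \<forall>v\<in>{x i..x (Suc i)}. f v - f u = c * (\<psi> v - \<psi> u)"
    and G: "\<And>i. i < n \<Longrightarrow> \<exists>c. \<forall>u\<in>{x i..x (Suc i)}. \<forall>v\<in>{x i..x (Suc i)}. G v - G u = c * (\<psi> v - \<psi> u)"
  shows "\<exists>K F. rs_primitive \<psi> f G K lo hi F"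
proof -
  \<comment> \<open>The Lipschitz bounds are carried along because \<open>rs_primitive_join\<close>
    consumes them. Monotonicity is a premise inside \<open>Q\<close> because the joining step of the
    induction ranges over arbitrary intervals, with no reference to \<open>[lo, hi]\<close>.\<close>
  define Q where "Q a b \<longleftrightarrow> mono_on {a..b} \<psi> \<longrightarrow> (\<exists>K F. 0 \<le> K \<and>
    clock_lipschitz \<psi> f K a b \<and> clock_lipschitz \<psi> G K a b \<and> (\<exists>K'\<ge>0. rs_primitive \<psi> f G K' a b F))" for a b
  have "Q lo hi"
    using P
  proof (rule partitions_induct)
    fix i assume i: "i < n"
    obtain c where c: "\<And>u v. u \<in> {x i..x (Suc i)} \<Longrightarrow> v \<in> {x i..x (Suc i)} \<Longrightarrow> f v - f u = c * (\<psi> v - \<psi> u)"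
      using f[OF i] by blast
    obtain d where d: "\<And>u v. u \<in> {x i..x (Suc i)} \<Longrightarrow> v \<in> {x i..x (Suc i)} \<Longrightarrow> G v - G u = d * (\<psi> v - \<psi> u)"
      using G[OF i] by blast
    show "Q (x i) (x (Suc i))"
      unfolding Q_def
    proof
      assume m: "mono_on {x i..x (Suc i)} \<psi>"
      have lip: "clock_lipschitz \<psi> H \<bar>e\<bar> (x i) (x (Suc i))"
        if "\<And>u v. u \<in> {x i..x (Suc i)} \<Longrightarrow> v \<in> {x i..x (Suc i)} \<Longrightarrow> H v - H u = e * (\<psi> v - \<psi> u)" for H e
        unfolding clock_lipschitz_def
      proof (intro allI impI, elim conjE)
        fix u v assume "x i \<le> u" "u \<le> v" "v \<le> x (Suc i)"
        with that[of u v] mono_onD[OF m, of u v] show "\<bar>H v - H u\<bar> \<le> \<bar>e\<bar> * (\<psi> v - \<psi> u)"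
          by (simp add: abs_mult)
      qed
      show "\<exists>K F. 0 \<le> K \<and> clock_lipschitz \<psi> f K (x i) (x (Suc i)) \<and>
          clock_lipschitz \<psi> G K (x i) (x (Suc i)) \<and>
          (\<exists>K'\<ge>0. rs_primitive \<psi> f G K' (x i) (x (Suc i)) F)"
      proof (intro exI conjI)
        show "0 \<le> \<bar>c\<bar> + \<bar>d\<bar>" by simp
        show "clock_lipschitz \<psi> f (\<bar>c\<bar> + \<bar>d\<bar>) (x i) (x (Suc i))"
          by (rule clock_lipschitz_mono[OF lip[OF c] _ m]) auto
        show "clock_lipschitz \<psi> G (\<bar>c\<bar> + \<bar>d\<bar>) (x i) (x (Suc i))"
          by (rule clock_lipschitz_mono[OF lip[OF d] _ m]) auto
        show "0 \<le> \<bar>c * d\<bar>" by simp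
        show "rs_primitive \<psi> f G \<bar>c * d\<bar> (x i) (x (Suc i)) (\<lambda>y. (f (x i) + f y) / 2 * (G y - G (x i)))"
          by (rule rs_primitive_linear[OF c d m])
      qed
    qed
  next
    fix a c b assume ac: "a \<le> c" "c \<le> b" and "Q a c" "Q c b"
    show "Q a b"
      unfolding Q_def
    proof
      assume m: "mono_on {a..b} \<psi>"
      then have m': "mono_on {a..c} \<psi>" "mono_on {c..b} \<psi>"
        using ac by (auto intro: mono_on_subset[OF m])
      obtain K1 K1' F1 where 1: "0 \<le> K1" "clock_lipschitz \<psi> f K1 a c" "clock_lipschitz \<psi> G K1 a c"
        "0 \<le> K1'" "rs_primitive \<psi> f G K1' a c F1"
        using \<open>Q a c\<close> m'(1) unfolding Q_def by blast
      obtain K2 K2' F2 where 2: "0 \<le> K2" "clock_lipschitz \<psi> f K2 c b" "clock_lipschitz \<psi> G K2 c b"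
        "0 \<le> K2'" "rs_primitive \<psi> f G K2' c b F2"
        using \<open>Q c b\<close> m'(2) unfolding Q_def by blast
      define K where "K = K1 + K2"
      have K: "0 \<le> K" "K1 \<le> K" "K2 \<le> K" using 1(1) 2(1) by (auto simp: K_def)
      have lip: "clock_lipschitz \<psi> f K a b" "clock_lipschitz \<psi> G K a b"
        using clock_lipschitz_mono[OF 1(2) K(2) m'(1)] clock_lipschitz_mono[OF 2(2) K(3) m'(2)]
          clock_lipschitz_mono[OF 1(3) K(2) m'(1)] clock_lipschitz_mono[OF 2(3) K(3) m'(2)]
        by (auto intro: clock_lipschitz_join)
      have "0 \<le> K1' + K2' + K\<^sup>2" using 1(4) 2(4) by simp
      with rs_primitive_join[OF 1(5) 2(5) 1(4) 2(4) K(1) lip m ac] K(1) lip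
      show "\<exists>K F. 0 \<le> K \<and> clock_lipschitz \<psi> f K a b \<and> clock_lipschitz \<psi> G K a b \<and>
          (\<exists>K'\<ge>0. rs_primitive \<psi> f G K' a b F)"
        by blast
    qed
  qed
  with mono show ?thesis unfolding Q_def by blast
qed

text \<open>This is the source of additivity. Since \<open>iter1 Y a s\<close> is
  \<open>Y s - Y a\<close>, the second iterated integral is the integral of the \<open>k\<close>-th
  coordinate against the \<open>l\<close>-th, minus the boundary term
  \<open>Y a $ k * (Y b $ l - Y a $ l)\<close>. Adding that term back leaves an increment of
  \<open>F\<close>.\<close>

lemma iter2_rs_primitive:
  assumes F: "rs_primitive \<psi> (\<lambda>x. Y x $ k) (\<lambda>x. Y x $ l) K lo hi F"
    and ab: "lo \<le> a" "a \<le> b" "b \<le> hi"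
    and \<psi>: "continuous_on {lo..hi} \<psi>" "mono_on {lo..hi} \<psi>"
  shows "Y a $ k * (Y b $ l - Y a $ l) + iter2 Y a b $ k $ l = F b - F a"
proof -
  have "((\<lambda>(n, x, s). \<Sum>i<n. iter1 Y a (s i) $ k * (Y (x (Suc i)) $ l - Y (x i) $ l))
      \<longlongrightarrow> (F b - F a) - Y a $ k * (Y b $ l - Y a $ l)) (tagged_mesh_to_0 a b)"
  proof (rule Lim_transform_eventually)
    show "((\<lambda>t. (case t of (n, x, s) \<Rightarrow> \<Sum>i<n. Y (s i) $ k * (Y (x (Suc i)) $ l - Y (x i) $ l))
        - Y a $ k * (Y b $ l - Y a $ l)) \<longlongrightarrow> (F b - F a) - Y a $ k * (Y b $ l - Y a $ l))
        (tagged_mesh_to_0 a b)"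
      using tendsto_rs_primitive[OF F ab(1,3) \<psi>] by (intro tendsto_diff tendsto_const) simp
    have "(\<Sum>i<n. Y (s i) $ k * (Y (x (Suc i)) $ l - Y (x i) $ l)) - Y a $ k * (Y b $ l - Y a $ l)
        = (\<Sum>i<n. iter1 Y a (s i) $ k * (Y (x (Suc i)) $ l - Y (x i) $ l))"
      if P: "(n, x) \<in> partitions a b" and s: "\<forall>i<n. s i \<in> {x i..x (Suc i)}" for n x s
    proof -
      have "iter1 Y a (s i) $ k = Y (s i) $ k - Y a $ k" if "i < n" for i
        using rs_integral_one[of a "s i"] partitions_bounds(1)[OF P, of i] s that
        by (fastforce simp: iter1_def)
      then have "(\<Sum>i<n. iter1 Y a (s i) $ k * (Y (x (Suc i)) $ l - Y (x i) $ l))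
          = (\<Sum>i<n. Y (s i) $ k * (Y (x (Suc i)) $ l - Y (x i) $ l)
              - Y a $ k * (Y (x (Suc i)) $ l - Y (x i) $ l))"
        by (intro sum.cong) (auto simp: left_diff_distrib)
      also have "\<dots> = (\<Sum>i<n. Y (s i) $ k * (Y (x (Suc i)) $ l - Y (x i) $ l))
          - Y a $ k * (Y b $ l - Y a $ l)"
        using sum_lessThan_telescope[of "\<lambda>i. Y (x i) $ l" n] P
        by (simp add: sum_subtractf sum_distrib_left[symmetric] partitions_def)
      finally show ?thesis by simp
    qed
    then show "\<forall>\<^sub>F t in tagged_mesh_to_0 a b.
        (case t of (n, x, s) \<Rightarrow> \<Sum>i<n. Y (s i) $ k * (Y (x (Suc i)) $ l - Y (x i) $ l))
          - Y a $ k * (Y b $ l - Y a $ l)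
        = (case t of (n, x, s) \<Rightarrow> \<Sum>i<n. iter1 Y a (s i) $ k * (Y (x (Suc i)) $ l - Y (x i) $ l))"
      unfolding eventually_tagged_mesh_to_0 by (intro exI[of _ 1]) auto
  qed
  from rs_integral_eqI[OF ab(2) this] show ?thesis by (simp add: iter2_def)
qed

section \<open>The interpolated paths\<close>

text \<open>Superadditivity makes \<open>w lo\<close> nondecreasing, and the extra length in
  \<open>w1\<close> makes clock increments dominate lengths. The latter forces the mesh of the
  dyadic points to zero.\<close>

lemma control_w1:
  assumes w: "control lo hi w"
  shows w1_increment: "\<And>u v. lo \<le> u \<Longrightarrow> u \<le> v \<Longrightarrow> v \<le> hi \<Longrightarrow> v - u \<le> w1 w lo v - w1 w lo u"
    and continuous_on_w1: "continuous_on {lo..hi} (w1 w lo)"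
    and mono_on_w1: "mono_on {lo..hi} (w1 w lo)"
proof -
  show inc: "v - u \<le> w1 w lo v - w1 w lo u" if "lo \<le> u" "u \<le> v" "v \<le> hi" for u v
  proof -
    have "w lo u + w u v \<le> w lo v" "0 \<le> w u v"
      using w that by (auto simp: control_def ordered_pairs_def)
    then show ?thesis by (simp add: w1_def)
  qed
  have "continuous_on {lo..hi} ((\<lambda>(a, b). w a b) \<circ> (\<lambda>x. (lo, x)))"
    using w unfolding control_def
    by (intro continuous_on_compose continuous_intros)
       (auto elim!: continuous_on_subset simp: ordered_pairs_def)
  then show "continuous_on {lo..hi} (w1 w lo)"
    unfolding w1_def[abs_def] by (intro continuous_intros) (simp add: comp_def)
  show "mono_on {lo..hi} (w1 w lo)"
  proof (rule mono_onI)
    fix u v assume "u \<in> {lo..hi}" "v \<in> {lo..hi}" "u \<le> v"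
    with inc[of u v] show "w1 w lo u \<le> w1 w lo v" by simp
  qed
qed

lemma dyadic_points_partition:
  assumes "dyadic_points w lo hi \<xi>"
  shows "(2 ^ m, \<xi> m) \<in> partitions lo hi"
  using assms by (simp add: dyadic_points_def partitions_def)

lemma dyadic_points_increment:
  assumes "dyadic_points w lo hi \<xi>" "l < 2 ^ m"
  shows "w1 w lo (\<xi> m (Suc l)) - w1 w lo (\<xi> m l) = w1 w lo hi / 2 ^ m"
  using assms by (simp add: dyadic_points_def)

lemma w1_pos:
  assumes "control lo hi w" "lo < hi"
  shows "0 < w1 w lo hi"
  using assms by (auto simp: control_def w1_def ordered_pairs_def intro!: add_nonneg_pos)

text \<open>The \<open>LEAST\<close> in the definition can miss the given piece only if
  \<open>x\<close> is its left endpoint. The piece chosen instead then ends at \<open>x\<close>, its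
  interpolation parameter is 1, and both formulas give \<open>Z x\<close>.\<close>

lemma interpolation_eq:
  assumes w: "control lo hi w" and "lo < hi" and pts: "dyadic_points w lo hi \<xi>"
    and l: "l < 2 ^ m" and x: "\<xi> m l \<le> x" "x \<le> \<xi> m (Suc l)"
  shows "interpolation w lo \<xi> Z m x = Z (\<xi> m l) +
    ((w1 w lo x - w1 w lo (\<xi> m l)) / (w1 w lo hi / 2 ^ m)) *\<^sub>R (Z (\<xi> m (Suc l)) - Z (\<xi> m l))"
proof -
  note P = dyadic_points_partition[OF pts, of m]
  define j where "j = (LEAST l. x \<le> \<xi> m (Suc l))"
  have j: "x \<le> \<xi> m (Suc j)" "j \<le> l"
    unfolding j_def using x by (auto intro: LeastI Least_le)
  have eq: "interpolation w lo \<xi> Z m x = Z (\<xi> m j) +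
      ((w1 w lo x - w1 w lo (\<xi> m j)) / (w1 w lo hi / 2 ^ m)) *\<^sub>R (Z (\<xi> m (Suc j)) - Z (\<xi> m j))"
    using dyadic_points_increment[OF pts, of j m] j l
    by (simp add: interpolation_def Let_def flip: j_def)
  show ?thesis
  proof (cases "j = l")
    case True
    with eq show ?thesis by simp
  next
    case False
    with j have "Suc j \<le> l" by simp
    then have "\<xi> m (Suc j) \<le> \<xi> m l" using partitions_mono[OF P, of "Suc j" l] l by simp
    with j x have xl: "x = \<xi> m l" "\<xi> m (Suc j) = \<xi> m l" by auto
    have "w1 w lo x - w1 w lo (\<xi> m j) = w1 w lo hi / 2 ^ m"
      using dyadic_points_increment[OF pts, of j m] j l xl by simp
    with eq xl w1_pos[OF w \<open>lo < hi\<close>] show ?thesis by simp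
  qed
qed

lemma interpolation_affine:
  assumes w: "control lo hi w" and "lo < hi" and pts: "dyadic_points w lo hi \<xi>" and l: "l < 2 ^ m"
  shows "\<exists>c. \<forall>u\<in>{\<xi> m l..\<xi> m (Suc l)}. \<forall>v\<in>{\<xi> m l..\<xi> m (Suc l)}.
    interpolation w lo \<xi> Z m v $ k - interpolation w lo \<xi> Z m u $ k = c * (w1 w lo v - w1 w lo u)"
proof (intro exI[of _ "(Z (\<xi> m (Suc l)) $ k - Z (\<xi> m l) $ k) / (w1 w lo hi / 2 ^ m)"] ballI)
  fix u v assume "u \<in> {\<xi> m l..\<xi> m (Suc l)}" "v \<in> {\<xi> m l..\<xi> m (Suc l)}"
  then show "interpolation w lo \<xi> Z m v $ k - interpolation w lo \<xi> Z m u $ k =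
      (Z (\<xi> m (Suc l)) $ k - Z (\<xi> m l) $ k) / (w1 w lo hi / 2 ^ m) * (w1 w lo v - w1 w lo u)"
    using w1_pos[OF w \<open>lo < hi\<close>] by (simp add: interpolation_eq[OF assms] field_simps)
qed

text \<open>The piece around \<open>x\<close> has length at most \<open>w1 w lo hi / 2 ^ m\<close>,
  so both of its endpoints are eventually close to \<open>x\<close>. The interpolated value is a
  convex combination of the values of \<open>Z\<close> there, and balls are convex.\<close>

lemma interpolation_tendsto:
  assumes w: "control lo hi w" and "lo < hi" and pts: "dyadic_points w lo hi \<xi>"
    and Z: "continuous_on {lo..hi} Z" and x: "x \<in> {lo..hi}"
  shows "(\<lambda>m. interpolation w lo \<xi> Z m x) \<longlonglongrightarrow> Z x"
proof (rule metric_LIMSEQ_I)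
  fix e :: real assume "e > 0"
  then obtain d where "d > 0" and d: "\<And>y. y \<in> {lo..hi} \<Longrightarrow> dist y x < d \<Longrightarrow> dist (Z y) (Z x) < e"
    using Z x unfolding continuous_on_iff by blast
  let ?W = "w1 w lo hi"
  have "(\<lambda>m. ?W / 2 ^ m) \<longlonglongrightarrow> 0" by (intro LIMSEQ_divide_realpow_zero) simp
  then obtain N where N: "\<And>m. m \<ge> N \<Longrightarrow> ?W / 2 ^ m < d"
    using \<open>d > 0\<close> by (metis (no_types, lifting) eventually_sequentially order_tendstoD(2))
  have "dist (interpolation w lo \<xi> Z m x) (Z x) < e" if "m \<ge> N" for m
  proof -
    note P = dyadic_points_partition[OF pts, of m]
    obtain l where l: "l < 2 ^ m" "\<xi> m l \<le> x" "x \<le> \<xi> m (Suc l)"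
      using partitions_piece_exists[OF P \<open>lo < hi\<close>] x by auto
    let ?t = "(w1 w lo x - w1 w lo (\<xi> m l)) / (?W / 2 ^ m)"
    have b: "\<xi> m l \<in> {lo..hi}" "\<xi> m (Suc l) \<in> {lo..hi}"
      using partitions_bounds[OF P] l by auto
    note inc = dyadic_points_increment[OF pts l(1)]
    have W: "?W / 2 ^ m > 0" using w1_pos[OF w \<open>lo < hi\<close>] by simp
    have w1x: "w1 w lo (\<xi> m l) \<le> w1 w lo x" "w1 w lo x \<le> w1 w lo (\<xi> m (Suc l))"
      using mono_onD[OF mono_on_w1[OF w] b(1) x l(2)] mono_onD[OF mono_on_w1[OF w] x b(2) l(3)] by auto
    have t: "0 \<le> ?t"
      using w1x W by (intro divide_nonneg_pos) auto
    have t': "?t \<le> 1"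
      unfolding divide_le_eq_1_pos[OF W] using w1x inc by linarith
    have "\<xi> m (Suc l) - \<xi> m l < d"
      using w1_increment[OF w, of "\<xi> m l" "\<xi> m (Suc l)"] inc N[OF that] b l by simp
    then have near: "Z (\<xi> m l) \<in> ball (Z x) e" "Z (\<xi> m (Suc l)) \<in> ball (Z x) e"
      using d[OF b(1)] d[OF b(2)] l by (auto simp: dist_real_def dist_commute)
    have "interpolation w lo \<xi> Z m x = (1 - ?t) *\<^sub>R Z (\<xi> m l) + ?t *\<^sub>R Z (\<xi> m (Suc l))"
      unfolding interpolation_eq[OF w \<open>lo < hi\<close> pts l] by (simp add: algebra_simps)
    also have "\<dots> \<in> ball (Z x) e"
      using near t t' by (intro convexD[OF convex_ball]) auto
    finally show ?thesis by (simp add: dist_commute)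
  qed
  then show "\<exists>N. \<forall>m\<ge>N. dist (interpolation w lo \<xi> Z m x) (Z x) < e" by blast
qed

section \<open>Passing to the limit\<close>

text \<open>Of a partition having \<open>[a, b]\<close> as a piece only that summand is kept, and
  the exponents \<open>\<theta> / j\<close> and \<open>j / \<theta>\<close> cancel.\<close>

lemma norm_le_level_distance:
  assumes "lo \<le> a" "a < b" "b \<le> hi" "0 < \<theta>" "0 < j"
  shows "ennreal (norm (S a b - T a b)) \<le> level_distance \<theta> lo hi j S T"
proof -
  obtain n x i where P: "(n, x) \<in> partitions lo hi" and i: "i < n" "x i = a" "x (Suc i) = b"
    using partition_through[OF assms(1-3)] by blast
  let ?N = "\<lambda>i. norm (S (x i) (x (Suc i)) - T (x i) (x (Suc i))) powr (\<theta> / real j)"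
  have "?N i \<le> (\<Sum>i<n. ?N i)"
    using i by (intro member_le_sum) auto
  then have "?N i powr (real j / \<theta>) \<le> (\<Sum>i<n. ?N i) powr (real j / \<theta>)"
    using assms by (intro powr_mono2) auto
  moreover have "?N i powr (real j / \<theta>) = norm (S a b - T a b)"
    using assms by (simp add: i powr_powr)
  ultimately have "ennreal (norm (S a b - T a b)) \<le> ennreal ((\<Sum>i<n. ?N i) powr (real j / \<theta>))"
    by (simp add: ennreal_leI)
  also have "\<dots> \<le> level_distance \<theta> lo hi j S T"
    unfolding level_distance_def by (rule SUP_upper2[OF P]) simp
  finally show ?thesis .
qed

lemma level2_tendsto:
  assumes "(\<lambda>m. variation_distance \<theta> lo hi (S m) T) \<longlonglongrightarrow> 0"
    and ab: "lo \<le> a" "a < b" "b \<le> hi" and "0 < \<theta>"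
  shows "(\<lambda>m. level2 (S m) a b) \<longlonglongrightarrow> level2 T a b"
proof -
  have "(\<lambda>m. ennreal (norm (level2 (S m) a b - level2 T a b))) \<longlonglongrightarrow> ennreal 0"
  proof (rule tendsto_sandwich[OF _ _ tendsto_const])
    show "(\<lambda>m. variation_distance \<theta> lo hi (S m) T) \<longlonglongrightarrow> ennreal 0" using assms(1) by simp
    have "ennreal (norm (level2 (S m) a b - level2 T a b)) \<le> variation_distance \<theta> lo hi (S m) T" for m
    proof (rule order.trans[OF norm_le_level_distance[OF ab \<open>0 < \<theta>\<close>, of 2]])
      show "level_distance \<theta> lo hi 2 (level2 (S m)) (level2 T) \<le> variation_distance \<theta> lo hi (S m) T"
        unfolding variation_distance_def by (rule Max_ge) auto
    qed simp
    then show "\<forall>\<^sub>F m in sequentially. ennreal (norm (level2 (S m) a b - level2 T a b))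
        \<le> variation_distance \<theta> lo hi (S m) T" by simp
  qed simp
  then have "(\<lambda>m. norm (level2 (S m) a b - level2 T a b)) \<longlonglongrightarrow> 0"
    by (subst (asm) tendsto_ennreal_iff) auto
  then show ?thesis using Lim_null tendsto_norm_zero_iff by blast
qed

text \<open>The deterministic core, applied to one sample path at a time. The primitives
  \<open>F m\<close> are fixed only up to additive constants, so convergence is claimed for their
  increments alone.\<close>

lemma rough_integral_exists:
  assumes w: "control lo hi w" and "lo < hi" and pts: "dyadic_points w lo hi \<xi>"
    and Z: "continuous_on {lo..hi} Z" and "0 < \<theta>"
    and conv: "(\<lambda>m. variation_distance \<theta> lo hi (iterated_integrals (interpolation w lo \<xi> Z m)) T) \<longlonglongrightarrow> 0"
    and ab: "(a, b) \<in> ordered_pairs lo hi"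
  shows "\<exists>I. ((\<lambda>(r, x). \<Sum>i<r. Z (x i) $ k * (Z (x (Suc i)) $ l - Z (x i) $ l)
    + level2 T (x i) (x (Suc i)) $ k $ l) \<longlongrightarrow> I) (mesh_to_0 a b)"
proof -
  define Y where "Y m = interpolation w lo \<xi> Z m" for m
  define A where "A u v = Z u $ k * (Z v $ l - Z u $ l) + level2 T u v $ k $ l" for u v
  have "\<exists>K F. rs_primitive (w1 w lo) (\<lambda>x. Y m x $ k) (\<lambda>x. Y m x $ l) K lo hi F" for m
    unfolding Y_def
    by (rule rs_primitive_exists[OF dyadic_points_partition[OF pts, of m] \<open>lo < hi\<close> mono_on_w1[OF w]];
        rule interpolation_affine[OF w \<open>lo < hi\<close> pts])
  then obtain K F where F: "\<And>m. rs_primitive (w1 w lo) (\<lambda>x. Y m x $ k) (\<lambda>x. Y m x $ l) (K m) lo hi (F m)"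
    by metis
  have lim: "(\<lambda>m. F m v - F m u) \<longlonglongrightarrow> A u v" if "lo \<le> u" "u < v" "v \<le> hi" for u v
  proof -
    have "(\<lambda>m. Y m u $ k * (Y m v $ l - Y m u $ l) + level2 (iterated_integrals (Y m)) u v $ k $ l)
        \<longlonglongrightarrow> A u v"
      unfolding A_def Y_def using that
      by (intro tendsto_intros interpolation_tendsto[OF w \<open>lo < hi\<close> pts Z]
          level2_tendsto[OF conv _ _ _ \<open>0 < \<theta>\<close>]) auto
    moreover have "Y m u $ k * (Y m v $ l - Y m u $ l) + level2 (iterated_integrals (Y m)) u v $ k $ l
        = F m v - F m u" for m
      using iter2_rs_primitive[OF F, of u v m] that continuous_on_w1[OF w] mono_on_w1[OF w]
      by (simp add: level2_def iterated_integrals_def)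
    ultimately show ?thesis by simp
  qed
  have ab: "lo \<le> a" "a \<le> b" "b \<le> hi" using ab by (auto simp: ordered_pairs_def)
  \<comment> \<open>The pieces of partitions are nondegenerate, and \<open>lim\<close> covers only
    such intervals. For \<open>a = b\<close> the only partition has no pieces, and the value is
    0.\<close>
  obtain I where I: "(\<lambda>m. F m b - F m a) \<longlonglongrightarrow> I"
  proof (cases "a = b")
    case True
    then show thesis using that[of 0] by simp
  next
    case False
    then show thesis using that lim[of a b] ab by simp
  qed
  have "(\<Sum>i<r. A (x i) (x (Suc i))) = I" if P: "(r, x) \<in> partitions a b" for r x
  proof -
    have x: "x 0 = a" "x r = b" "\<And>i. i < r \<Longrightarrow> x i < x (Suc i)"
      using P by (auto simp: partitions_def)
    \<comment> \<open>For each \<open>m\<close> the sum telescopes to \<open>F m b - F m a\<close>,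
      so its limit \<open>I\<close> is the same for every partition.\<close>
    have "(\<lambda>m. \<Sum>i<r. F m (x (Suc i)) - F m (x i)) \<longlonglongrightarrow> (\<Sum>i<r. A (x i) (x (Suc i)))"
    proof (intro tendsto_sum lim)
      fix i assume "i \<in> {..<r}"
      then show "lo \<le> x i" "x i < x (Suc i)" "x (Suc i) \<le> hi"
        using partitions_bounds[OF P, of i] partitions_bounds[OF P, of "Suc i"] x(3) ab by auto
    qed
    also have "(\<lambda>m. \<Sum>i<r. F m (x (Suc i)) - F m (x i)) = (\<lambda>m. F m b - F m a)"
      using x by (simp add: sum_lessThan_telescope[where f="\<lambda>i. F _ (x i)"])
    finally show ?thesis using I LIMSEQ_unique by blast
  qed
  then have "((\<lambda>(r, x). \<Sum>i<r. A (x i) (x (Suc i))) \<longlongrightarrow> I) (mesh_to_0 a b)"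
    \<comment> \<open>The sums are constant over all partitions, so any mesh bound will do; 1 is
      arbitrary.\<close>
    by (intro tendsto_eventually) (auto simp: eventually_mesh_to_0 intro!: exI[of _ 1])
  then show ?thesis unfolding A_def by blast
qed

theorem corollary3p20:
  fixes M :: "'a measure"
    and X :: "real \<Rightarrow> 'a \<Rightarrow> real"
    and L :: "real \<Rightarrow> real \<Rightarrow> 'a \<Rightarrow> real"
    and g :: "real \<Rightarrow> real"
    and w :: "real \<Rightarrow> real \<Rightarrow> real"
    and \<xi> :: "nat \<Rightarrow> nat \<Rightarrow> real"
    and ZZ :: "'a \<Rightarrow> tensor_path"
    and \<alpha> q p \<theta> t lo hi qhat h :: real
  assumes alpha: "3 / 2 < \<alpha>" "\<alpha> < 2"
    and stable: "symmetric_stable_process M \<alpha> X"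
    and lt: "local_time M X L"
    and t: "0 \<le> t"
    and interval: "lo < hi"
    and q: "2 / (3 - \<alpha>) < q" "q < 4"
    and g: "continuous_on {lo..hi} g" "bounded_q_variation q lo hi g"
    and w: "control lo hi w"
    and gw: "\<forall>(a, b)\<in>ordered_pairs lo hi. \<bar>g b - g a\<bar> powr q \<le> w a b"
    and p: "2 / (\<alpha> - 1) < p" "p < 4"
    and qhat: "qhat = max p q"
    and h: "h = 1 / qhat"
    and theta: "qhat < \<theta>" "4 / (2 * h + \<alpha> - 1) < \<theta>" "\<theta> < 4"
    and pts: "dyadic_points w lo hi \<xi>"
    and ZZ: "associated_rough_path M \<theta> lo hi w \<xi> (\<lambda>\<omega> x. vector [L t x \<omega>, g x]) ZZ"
  shows "AE \<omega> in M. \<forall>(a, b)\<in>ordered_pairs lo hi. \<exists>I.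
    ((\<lambda>(r, x). \<Sum>i<r. g (x i) * (L t (x (Suc i)) \<omega> - L t (x i) \<omega>)
        + level2 (ZZ \<omega>) (x i) (x (Suc i)) $ 2 $ 1) \<longlongrightarrow> I) (mesh_to_0 a b)"
proof -
  have "0 < 2 / (\<alpha> - 1)" using alpha by simp
  \<comment> \<open>Positivity of \<open>\<theta>\<close> is what lets the exponents in the
    variation distance cancel.\<close>
  then have "0 < \<theta>" using p(1) qhat theta(1) by linarith
  have "AE \<omega> in M. continuous_on ({0..} \<times> UNIV) (\<lambda>(t, x). L t x \<omega>)"
    using lt unfolding local_time_def by auto
  then show ?thesis
    using ZZ unfolding associated_rough_path_def
  proof eventually_elim
    case (elim \<omega>)
    let ?Z = "\<lambda>x. vector [L t x \<omega>, g x] :: real ^ 2"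
    have "continuous_on {lo..hi} ((\<lambda>(t, x). L t x \<omega>) \<circ> (\<lambda>x. (t, x)))"
      using t by (intro continuous_on_compose continuous_intros continuous_on_subset[OF elim(1)]) auto
    then have "continuous_on {lo..hi} (\<lambda>x. L t x \<omega>)" by (simp add: comp_def)
    then have "continuous_on {lo..hi} ?Z"
      using g(1) by (subst continuous_on_componentwise) (auto simp: Basis_vec_def axis_eq_axis inner_axis forall_2)
    \<comment> \<open>Coordinate 1 is the local time and coordinate 2 is \<open>g\<close>, so the
      indices 2 and 1 select the integral of \<open>g\<close> against the local time and the
      lower-left entry of the second level.\<close>
    from rough_integral_exists[OF w interval pts this \<open>0 < \<theta>\<close> elim(2), of _ _ 2 1]
    show ?case by (auto simp: vector_2)
  qed
qed

end
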